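(* Let $0<q<1$, let $\alpha>\beta>0$, $\gamma,\delta>0$ satisfy $\gamma+\delta=\alpha-\beta=1$, and let $z,t_1,t_2,t_3\in\mathbb C$ with $z\,t_1t_2t_3\ne0$. Put $$x_2(n)=\frac{q^{-n\alpha}z-q^{n\alpha}/z}{2}.$$ Then there exists a positive number $\eta$ with $$0<\eta<\min\{1,\ \alpha+\beta,\ \beta+\delta,\ \beta+\gamma\}$$ such that $$V_n\left(x_2(n);\,t_1q^{-n\beta},\,t_2q^{-n\gamma},\,t_3q^{-n\delta}\,|\,q\right)=\frac{t_1^n}{q^{n^2\beta+n}}\left(A_q\left(\frac{q^2z}{t_1t_2t_3}\right)+\mathcal O(q^{\eta n})\right)\qquad\text{as } n\to\infty.$$
   Context: Notation: $(a;q)_n=\prod_{j=0}^{n-1}(1-aq^j)$, $(a_1,\dots,a_r;q)_n=\prod_i(a_i;q)_n$, and ${}_3\phi_2\left(\begin{matrix}a_1,a_2,a_3\\ b_1,b_2\end{matrix}\Big|\,q,y\right)=\sum_{k\ge0}\frac{(a_1,a_2,a_3;q)_k}{(q,b_1,b_2;q)_k}y^k$. In $-q^2/t_1t_3$ etc. the denominator is the product $t_1t_3$. For $x=(\zeta-1/\zeta)/2$ the polynomials $V_n$ (of degree $n$ in $x$) are $$V_n(x;t_1,t_2,t_3|q)=\left(\frac{t_1}{q}\right)^n\frac{(-q^2/t_1t_3;q)_n}{(-q^2/t_2t_3;q)_n}\;{}_3\phi_2\left(\begin{matrix}q^{-n},\,-q/(t_1\zeta),\,q\zeta/t_1\\ -q^2/t_1t_3,\,-q^2/t_1t_2\end{matrix}\Big|\,q,\,-\frac{q^{n+2}}{t_2t_3}\right).$$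 The Ramanujan ($q$-Airy) function is $A_q(y)=\sum_{n=0}^\infty\frac{q^{n^2}}{(q;q)_n}(-y)^n$. *)

theory Defs
  imports Complex_Main "HOL-Library.Landau_Symbols"
begin

definition qpoch :: "complex \<Rightarrow> complex \<Rightarrow> nat \<Rightarrow> complex" where
  "qpoch a q n = (\<Prod>j<n. 1 - a * q ^ j)"

definition qpochs :: "complex list \<Rightarrow> complex \<Rightarrow> nat \<Rightarrow> complex" where
  "qpochs as q n = (\<Prod>a\<leftarrow>as. qpoch a q n)"

definition phi32 ::
  "complex \<Rightarrow> complex \<Rightarrow> complex \<Rightarrow> complex \<Rightarrow> complex \<Rightarrow> complex \<Rightarrow> complex \<Rightarrow> complex" where
  "phi32 a1 a2 a3 b1 b2 q y =
     (\<Sum>k. qpochs [a1, a2, a3] q k / qpochs [q, b1, b2] q k * y ^ k)"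

definition V_zeta ::
  "nat \<Rightarrow> complex \<Rightarrow> complex \<Rightarrow> complex \<Rightarrow> complex \<Rightarrow> complex \<Rightarrow> complex" where
  "V_zeta n \<zeta> t1 t2 t3 q =
     (t1 / q) ^ n * (qpoch (- (q ^ 2) / (t1 * t3)) q n / qpoch (- (q ^ 2) / (t2 * t3)) q n) *
     phi32 (q powi (- int n)) (- q / (t1 * \<zeta>)) (q * \<zeta> / t1)
           (- (q ^ 2) / (t1 * t3)) (- (q ^ 2) / (t1 * t2))
           q (- (q ^ (n + 2)) / (t2 * t3))"

text \<open>
  As a function of \<open>x\<close>: the equation \<open>x = (\<zeta> - 1/\<zeta>)/2\<close> has the solutions \<open>\<zeta>\<close> and \<open>-1/\<zeta>\<close>,
  and the expression above takes the same value at both, so the choice made here is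
  immaterial; see \<open>V_eq_V_zeta\<close> below.
\<close>

definition V ::
  "nat \<Rightarrow> complex \<Rightarrow> complex \<Rightarrow> complex \<Rightarrow> complex \<Rightarrow> complex \<Rightarrow> complex" where
  "V n x t1 t2 t3 q = V_zeta n (SOME \<zeta>. \<zeta> \<noteq> 0 \<and> x = (\<zeta> - 1 / \<zeta>) / 2) t1 t2 t3 q"

lemma phi32_swap: "phi32 a1 a2 a3 b1 b2 q y = phi32 a1 a3 a2 b1 b2 q y"
  unfolding phi32_def qpochs_def by (simp only: list.map prod_list.Cons mult.left_commute)

lemma V_zeta_swap:
  assumes "\<zeta> \<noteq> 0"
  shows "V_zeta n (- 1 / \<zeta>) t1 t2 t3 q = V_zeta n \<zeta> t1 t2 t3 q"
proof -
  have swap: "- q / (t1 * (- 1 / \<zeta>)) = q * \<zeta> / t1" "q * (- 1 / \<zeta>) / t1 = - q / (t1 * \<zeta>)"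
    using assms by simp_all
  show ?thesis
    unfolding V_zeta_def swap by (subst phi32_swap) (rule refl)
qed

lemma V_eq_V_zeta:
  assumes "\<zeta> \<noteq> 0"
  shows "V n ((\<zeta> - 1 / \<zeta>) / 2) t1 t2 t3 q = V_zeta n \<zeta> t1 t2 t3 q"
proof -
  define \<xi> where "\<xi> = (SOME \<xi>. \<xi> \<noteq> 0 \<and> (\<zeta> - 1 / \<zeta>) / 2 = (\<xi> - 1 / \<xi>) / 2)"
  have \<xi>: "\<xi> \<noteq> 0 \<and> (\<zeta> - 1 / \<zeta>) / 2 = (\<xi> - 1 / \<xi>) / 2"
    unfolding \<xi>_def by (rule someI[of _ \<zeta>]) (rule conjI[OF assms refl])
  have "\<xi> \<noteq> 0"
    using \<xi> by (rule conjunct1)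
  have eq: "\<zeta> - 1 / \<zeta> = \<xi> - 1 / \<xi>"
    using conjunct2[OF \<xi>] by (simp only: divide_cancel_right) simp
  have "(\<xi> - \<zeta>) * (\<xi> * \<zeta> + 1) = \<xi> * \<zeta> * ((\<xi> - 1 / \<xi>) - (\<zeta> - 1 / \<zeta>))"
    using \<open>\<xi> \<noteq> 0\<close> assms by (simp add: algebra_simps)
  also have "\<dots> = 0"
    unfolding eq by (simp only: diff_self mult_zero_right)
  finally have "\<xi> - \<zeta> = 0 \<or> \<xi> * \<zeta> + 1 = 0"
    by (simp only: mult_eq_0_iff)
  then have "\<xi> = \<zeta> \<or> \<xi> = - 1 / \<zeta>"
    using assms by (simp only: right_minus_eq nonzero_eq_divide_eq eq_neg_iff_add_eq_0 simp_thms)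
  then have "V_zeta n \<xi> t1 t2 t3 q = V_zeta n \<zeta> t1 t2 t3 q"
    using V_zeta_swap[OF assms] by (elim disjE) (simp_all only:)
  then show ?thesis
    unfolding V_def \<xi>_def .
qed

definition ramanujan_A :: "complex \<Rightarrow> complex \<Rightarrow> complex" where
  "ramanujan_A q y = (\<Sum>n. q ^ (n ^ 2) / qpoch q q n * (- y) ^ n)"

definition x2 :: "real \<Rightarrow> real \<Rightarrow> complex \<Rightarrow> nat \<Rightarrow> complex" where
  "x2 q \<alpha> z n =
     (complex_of_real (q powr (- real n * \<alpha>)) * z - complex_of_real (q powr (real n * \<alpha>)) / z) / 2"

end

theory Submission
  imports Defs "HOL-Analysis.Infinite_Products"
begin

text \<open>
  After cancelling the powers of \<open>q ^ n\<close>, the \<open>k\<close>-th term of the \<open>\<^sub>3\<phi>\<^sub>2\<close> series is the \<open>k\<close>-th term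
  of the Ramanujan series times a product of \<open>k\<close>-fold products that tend to 1. Each of these
  deviates from 1 by at most a constant times \<open>q ^ (n - k)\<close> or \<open>r n\<close>, where
  \<open>r n = q powr (\<eta> * n)\<close>. The loss \<open>q ^ (- k)\<close> is absorbed by the factor \<open>q ^ k\<^sup>2\<close> of the
  Ramanujan series, so that summing the termwise errors gives \<open>O(r n)\<close>.
\<close>

section \<open>Factors tending to 1, uniformly in \<open>k\<close>\<close>

text \<open>The uniform bound is part of the notion to make it stable under products. Dividing by
  \<open>q ^ k\<close> leaves room for errors of size q^(n-k). Only \<open>k \<le> n\<close> is
  constrained, since the terms of the terminating series vanish beyond \<open>n\<close>.\<close>

definition near_one :: "real \<Rightarrow> (nat \<Rightarrow> real) \<Rightarrow> (nat \<Rightarrow> nat \<Rightarrow> complex) \<Rightarrow> bool" where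
  "near_one q r f \<longleftrightarrow> (\<exists>C\<ge>0. \<forall>\<^sub>F n in sequentially. \<forall>k\<le>n.
     norm (f n k) \<le> C \<and> norm (f n k - 1) \<le> C * (r n / q ^ k))"

lemma near_oneI:
  assumes "\<forall>\<^sub>F n in sequentially. \<forall>k\<le>n. norm (f n k) \<le> C \<and> norm (f n k - 1) \<le> D * (r n / q ^ k)"
    and "0 < q" "\<And>n. 0 \<le> r n"
  shows "near_one q r f"
  unfolding near_one_def
proof (intro exI conjI)
  show "0 \<le> max 0 (max C D)" by simp
  show "\<forall>\<^sub>F n in sequentially. \<forall>k\<le>n. norm (f n k) \<le> max 0 (max C D) \<and>
          norm (f n k - 1) \<le> max 0 (max C D) * (r n / q ^ k)"
    using assms(1)
  proof eventually_elim
    case (elim n)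
    show ?case
    proof (intro allI impI conjI)
      fix k assume k: "k \<le> n"
      show "norm (f n k) \<le> max 0 (max C D)" using elim k by fastforce
      have "D * (r n / q ^ k) \<le> max 0 (max C D) * (r n / q ^ k)"
        by (rule mult_right_mono) (use assms in auto)
      then show "norm (f n k - 1) \<le> max 0 (max C D) * (r n / q ^ k)" using elim k by fastforce
    qed
  qed
qed

text \<open>Write f g - 1 = (f - 1) g + (g - 1); the boundedness of \<open>g\<close> controls the
  first summand.\<close>

lemma near_one_mult:
  assumes f: "near_one q r f" and g: "near_one q r g" and "0 < q" "\<And>n. 0 \<le> r n"
  shows "near_one q r (\<lambda>n k. f n k * g n k)"
proof -
  obtain C where C: "C \<ge> 0" "\<forall>\<^sub>F n in sequentially. \<forall>k\<le>n.
      norm (f n k) \<le> C \<and> norm (f n k - 1) \<le> C * (r n / q ^ k)"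
    using f unfolding near_one_def by blast
  obtain D where D: "D \<ge> 0" "\<forall>\<^sub>F n in sequentially. \<forall>k\<le>n.
      norm (g n k) \<le> D \<and> norm (g n k - 1) \<le> D * (r n / q ^ k)"
    using g unfolding near_one_def by blast
  show ?thesis
  proof (rule near_oneI[where C = "C * D" and D = "C * D + D"])
    show "\<forall>\<^sub>F n in sequentially. \<forall>k\<le>n. norm (f n k * g n k) \<le> C * D \<and>
        norm (f n k * g n k - 1) \<le> (C * D + D) * (r n / q ^ k)"
      using C(2) D(2)
    proof eventually_elim
      case (elim n)
      show ?case
      proof (intro allI impI conjI)
        fix k assume "k \<le> n"
        then have f1: "norm (f n k) \<le> C" "norm (f n k - 1) \<le> C * (r n / q ^ k)"
          and g1: "norm (g n k) \<le> D" "norm (g n k - 1) \<le> D * (r n / q ^ k)"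
          using elim by auto
        show "norm (f n k * g n k) \<le> C * D"
          unfolding norm_mult by (intro mult_mono f1 g1 C) simp
        have "f n k * g n k - 1 = (f n k - 1) * g n k + (g n k - 1)"
          by (simp add: algebra_simps)
        also have "norm \<dots> \<le> norm (f n k - 1) * norm (g n k) + norm (g n k - 1)"
          using norm_triangle_ineq norm_mult by metis
        also have "\<dots> \<le> (C * (r n / q ^ k)) * D + D * (r n / q ^ k)"
          by (intro add_mono mult_mono f1 g1) (use assms C in auto)
        finally show "norm (f n k * g n k - 1) \<le> (C * D + D) * (r n / q ^ k)"
          by (simp add: algebra_simps add_divide_distrib)
      qed
    qed
  qed (use assms in auto)
qed

section \<open>Finite products and q-shifted factorials with small parameter\<close>

text \<open>Compare with the product of 1 + |f j|, which is at most e^s, and use e^s - 1 \<le> s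
  e^s. The separate bound \<open>B\<close> keeps the estimate linear in the small quantity
  \<open>s\<close>, with a fixed constant.\<close>

lemma norm_prod_minus_one_le:
  fixes f :: "nat \<Rightarrow> complex"
  assumes "(\<Sum>j\<in>A. norm (f j)) \<le> s" "s \<le> B"
  shows "norm ((\<Prod>j\<in>A. 1 + f j) - 1) \<le> s * exp B" "norm (\<Prod>j\<in>A. 1 + f j) \<le> exp B"
proof -
  have s0: "0 \<le> s" using assms(1) sum_nonneg[of A "\<lambda>j. norm (f j)"] by auto
  have "(\<Prod>j\<in>A. 1 + norm (f j)) \<le> (\<Prod>j\<in>A. exp (norm (f j)))"
    by (intro prod_mono) (auto simp: exp_ge_add_one_self add.commute)
  also have "\<dots> = exp (\<Sum>j\<in>A. norm (f j))"
    by (cases "finite A") (simp_all add: exp_sum)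
  also have "\<dots> \<le> exp s" using assms(1) by simp
  finally have P: "(\<Prod>j\<in>A. 1 + norm (f j)) \<le> exp s" .
  have "norm ((\<Prod>j\<in>A. 1 + f j) - 1) \<le> (\<Prod>j\<in>A. 1 + norm (f j)) - 1"
    by (rule norm_prod_minus1_le_prod_minus1)
  also have "\<dots> \<le> exp s - 1" using P by simp
  also have "\<dots> \<le> s * exp s"
  proof -
    have "1 + (-s) \<le> exp (-s)" by (rule exp_ge_add_one_self)
    then have "(1 - s) * exp s \<le> exp (-s) * exp s" by (intro mult_right_mono) auto
    then show ?thesis by (simp add: algebra_simps flip: exp_add)
  qed
  also have "\<dots> \<le> s * exp B" using assms(2) s0 by (intro mult_left_mono) auto
  finally show "norm ((\<Prod>j\<in>A. 1 + f j) - 1) \<le> s * exp B" .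
  have "norm (\<Prod>j\<in>A. 1 + f j) \<le> (\<Prod>j\<in>A. 1 + norm (f j))"
    unfolding prod_norm[symmetric]
    by (intro prod_mono) (auto intro: order_trans[OF norm_triangle_ineq])
  also have "\<dots> \<le> exp B" using P assms(2) by (meson exp_le_cancel_iff order_trans)
  finally show "norm (\<Prod>j\<in>A. 1 + f j) \<le> exp B" .
qed

lemma sum_power_le:
  fixes q :: real
  assumes "0 < q" "q < 1"
  shows "(\<Sum>j<k. q ^ j) \<le> 1 / (1 - q)"
  using assms by (simp add: sum_gp_strict divide_right_mono)

text \<open>The geometric series bounds the sum of |a| q^j by |a|/(1 - q), whatever the length
  \<open>k\<close>.\<close>

lemma norm_qpoch_minus_one_le:
  assumes "0 < q" "q < 1" "norm a / (1 - q) \<le> B"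
  shows "norm (qpoch a (complex_of_real q) k - 1) \<le> norm a / (1 - q) * exp B"
    and "norm (qpoch a (complex_of_real q) k) \<le> exp B"
proof -
  have "(\<Sum>j<k. norm (- a * complex_of_real q ^ j)) = norm a * (\<Sum>j<k. q ^ j)"
    using assms by (simp add: norm_mult norm_power sum_distrib_left)
  also have "\<dots> \<le> norm a * (1 / (1 - q))"
    by (intro mult_left_mono sum_power_le assms) auto
  finally have "(\<Sum>j<k. norm (- a * complex_of_real q ^ j)) \<le> norm a / (1 - q)" by simp
  from norm_prod_minus_one_le[OF this assms(3)]
  show "norm (qpoch a (complex_of_real q) k - 1) \<le> norm a / (1 - q) * exp B"
    and "norm (qpoch a (complex_of_real q) k) \<le> exp B"
    unfolding qpoch_def by simp_all
qed

text \<open>For large \<open>n\<close> the factorial is within 1/2 of 1, so its inverse has modulus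
  at most 2. The length \<open>m n k\<close> is left free to cover both the factors of the series,
  of length \<open>k\<close>, and the prefactor, of length \<open>n\<close>.\<close>

lemma near_one_qpoch:
  fixes m :: "nat \<Rightarrow> nat \<Rightarrow> nat"
  assumes q: "0 < q" "q < 1" and r: "\<And>n. 0 \<le> r n" "r \<longlonglongrightarrow> 0"
    and a: "\<And>n. norm (a n) \<le> A * r n"
  shows "near_one q r (\<lambda>n k. qpoch (a n) (complex_of_real q) (m n k))"
    and "near_one q r (\<lambda>n k. inverse (qpoch (a n) (complex_of_real q) (m n k)))"
proof -
  \<comment> \<open>The constant of \<open>norm_qpoch_minus_one_le\<close> for B = 1, valid once A
    r(n)/(1 - q) < 1.\<close>
  define K where "K = A / (1 - q) * exp 1"
  have lim: "(\<lambda>n. A / (1 - q) * r n) \<longlonglongrightarrow> 0" "(\<lambda>n. K * r n) \<longlonglongrightarrow> 0"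
    by (rule tendsto_mult_right_zero[OF r(2)])+
  have ev: "\<forall>\<^sub>F n in sequentially. A / (1 - q) * r n < 1" "\<forall>\<^sub>F n in sequentially. K * r n < 1/2"
    using order_tendstoD(2)[OF lim(1), of 1] order_tendstoD(2)[OF lim(2), of "1/2"] by auto
  have B: "\<forall>\<^sub>F n in sequentially. \<forall>k.
      norm (qpoch (a n) (complex_of_real q) k) \<le> exp 1 \<and>
      norm (qpoch (a n) (complex_of_real q) k - 1) \<le> K * r n \<and>
      norm (qpoch (a n) (complex_of_real q) k - 1) \<le> 1/2"
    using ev
  proof eventually_elim
    case (elim n)
    have le: "norm (a n) / (1 - q) \<le> A / (1 - q) * r n"
      using divide_right_mono[OF a[of n], of "1 - q"] q by simp
    then have le1: "norm (a n) / (1 - q) \<le> 1" using elim by simp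
    have "norm (a n) / (1 - q) * exp 1 \<le> K * r n"
      using mult_right_mono[OF le, of "exp 1"] by (simp add: K_def mult_ac)
    then show ?case
      using norm_qpoch_minus_one_le[OF q le1] elim by (meson order_trans less_imp_le)
  qed
  have K0: "K * r n \<ge> 0" for n
  proof -
    \<comment> \<open>The sign comes from \<open>A * r n\<close> dominating a norm.\<close>
    have "0 \<le> A * r n" using a[of n] norm_ge_zero order_trans by blast
    then have "0 \<le> (A * r n) * (exp 1 / (1 - q))"
      using q by (intro mult_nonneg_nonneg[of "A * r n"]) auto
    then show ?thesis by (simp add: K_def mult_ac)
  qed
  \<comment> \<open>No loss occurs for these factors; dividing by q^k \<le> 1 weakens the bound to
    the common form.\<close>
  have Krq: "K * r n \<le> K * (r n / q ^ k)" for n k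
  proof -
    have "K * r n * 1 \<le> K * r n * (1 / q ^ k)"
      using q power_le_one[of q k] by (intro mult_left_mono K0) simp
    then show ?thesis by simp
  qed
  show "near_one q r (\<lambda>n k. qpoch (a n) (complex_of_real q) (m n k))"
  proof (rule near_oneI[where C = "exp 1" and D = K])
    show "\<forall>\<^sub>F n in sequentially. \<forall>k\<le>n. norm (qpoch (a n) (complex_of_real q) (m n k)) \<le> exp 1 \<and>
        norm (qpoch (a n) (complex_of_real q) (m n k) - 1) \<le> K * (r n / q ^ k)"
      using B by eventually_elim (use Krq in \<open>blast intro: order_trans\<close>)
  qed (use q r in auto)
  have half: "norm p \<ge> 1/2" if "norm (p - 1) \<le> 1/2" for p :: complex
    using norm_triangle_ineq2[of 1 "1 - p"] that by (simp add: norm_minus_commute)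
  show "near_one q r (\<lambda>n k. inverse (qpoch (a n) (complex_of_real q) (m n k)))"
  proof (rule near_oneI[where C = 2 and D = "2 * K"])
    show "\<forall>\<^sub>F n in sequentially. \<forall>k\<le>n.
        norm (inverse (qpoch (a n) (complex_of_real q) (m n k))) \<le> 2 \<and>
        norm (inverse (qpoch (a n) (complex_of_real q) (m n k)) - 1) \<le> 2 * K * (r n / q ^ k)"
      using B
    proof eventually_elim
      case (elim n)
      show ?case
      proof (intro allI impI)
        fix k
        define p where "p = qpoch (a n) (complex_of_real q) (m n k)"
        have p: "norm (p - 1) \<le> K * r n" "norm p \<ge> 1/2"
          using elim half by (auto simp: p_def)
        then have p0: "p \<noteq> 0" by auto
        have ip: "norm (inverse p) \<le> 2"
          using le_imp_inverse_le[OF p(2)] by (simp add: norm_inverse)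
        have "inverse p - 1 = inverse p * (1 - p)" using p0 by (simp add: field_simps)
        then have "norm (inverse p - 1) = norm (inverse p) * norm (p - 1)"
          by (simp add: norm_mult norm_minus_commute)
        also have "\<dots> \<le> 2 * (K * r n)" by (intro mult_mono ip p) auto
        also have "\<dots> \<le> 2 * (K * (r n / q ^ k))" by (intro mult_left_mono Krq) simp
        finally show "norm (inverse (qpoch (a n) (complex_of_real q) (m n k))) \<le> 2 \<and>
          norm (inverse (qpoch (a n) (complex_of_real q) (m n k)) - 1) \<le> 2 * K * (r n / q ^ k)"
          using ip by (simp add: p_def)
      qed
    qed
  qed (use q r in auto)
qed

section \<open>Factorials with a parameter of size q^(-n)\<close>

text \<open>With c = 1/x, this is what remains of the factorial of x/q^n once the dominant part of
  each factor is taken out. The quotient \<open>q ^ n / q ^ j\<close> stands for q^(n-j) and stays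
  meaningful for j > n.\<close>

definition rev_qpoch :: "complex \<Rightarrow> complex \<Rightarrow> nat \<Rightarrow> nat \<Rightarrow> complex" where
  "rev_qpoch c q n k = (\<Prod>j<k. 1 - c * (q ^ n / q ^ j))"

text \<open>The deviations |c| q^(n-j) with j < k sum to at most L q^(n-k). This growing geometric
  sum is the source of the loss q^(-k).\<close>

lemma near_one_rev_qpoch:
  assumes q: "0 < q" "q < 1" and r: "\<And>n. q ^ n \<le> r n"
  shows "near_one q r (rev_qpoch c (complex_of_real q))"
proof -
  define L where "L = norm c / (1 - q)"
  have L0: "L \<ge> 0" using q by (simp add: L_def)
  have r0: "0 \<le> r n" for n using r[of n] q by (meson zero_le_power less_imp_le order_trans)
  have sum_inv: "(\<Sum>j<k. 1 / q ^ j) \<le> 1 / (1 - q) / q ^ k" for k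
  proof (induction k)
    case (Suc k)
    have "(\<Sum>j<Suc k. 1 / q ^ j) \<le> 1 / (1 - q) / q ^ k + 1 / q ^ k"
      using Suc by simp
    also have "\<dots> \<le> 1 / (1 - q) / q ^ Suc k"
    proof -
      \<comment> \<open>The gap between the two sides of the induction step, times q^k, is (1 -
        q)/q, written here unreduced.\<close>
      have "(1 - q) * (1 - q) / (q * (1 - q)) = 1 / (1 - q) / q - (1 / (1 - q) + 1)"
        using q by (simp add: divide_simps) (simp add: algebra_simps)
      moreover have "0 \<le> (1 - q) * (1 - q) / (q * (1 - q))" using q by simp
      ultimately have "1 / (1 - q) + 1 \<le> 1 / (1 - q) / q" by linarith
      then have "(1 / (1 - q) + 1) / q ^ k \<le> 1 / (1 - q) / q / q ^ k"
        using q by (intro divide_right_mono) auto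
      then show ?thesis by (simp add: add_divide_distrib mult_ac)
    qed
    finally show ?case .
  qed (use q in simp)
  have bound: "norm (rev_qpoch c (complex_of_real q) n k) \<le> exp L \<and>
      norm (rev_qpoch c (complex_of_real q) n k - 1) \<le> L * exp L * (r n / q ^ k)"
    if "k \<le> n" for n k
  proof -
    have "(\<Sum>j<k. norm (- c * (complex_of_real q ^ n / complex_of_real q ^ j)))
        = norm c * q ^ n * (\<Sum>j<k. 1 / q ^ j)"
      using q by (simp add: norm_mult norm_power norm_divide sum_distrib_left)
    also have "\<dots> \<le> norm c * q ^ n * (1 / (1 - q) / q ^ k)"
      by (intro mult_left_mono sum_inv) (use q in auto)
    also have "\<dots> = L * (q ^ n / q ^ k)" by (simp add: L_def)
    finally have s: "(\<Sum>j<k. norm (- c * (complex_of_real q ^ n / complex_of_real q ^ j)))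
        \<le> L * (q ^ n / q ^ k)" .
    \<comment> \<open>Here k \<le> n enters: it makes \<open>L\<close> a bound uniform in
      \<open>n\<close> and \<open>k\<close>.\<close>
    have "q ^ n / q ^ k \<le> 1"
      using q that by (simp add: power_decreasing)
    then have "L * (q ^ n / q ^ k) \<le> L" using L0 by (rule mult_left_le)
    note b = norm_prod_minus_one_le[OF s this]
    have "L * (q ^ n / q ^ k) * exp L \<le> L * (r n / q ^ k) * exp L"
      using r[of n] q L0 by (intro mult_right_mono mult_left_mono divide_right_mono) auto
    with b show ?thesis by (auto simp: rev_qpoch_def mult_ac)
  qed
  show ?thesis
    by (rule near_oneI[where C = "exp L" and D = "L * exp L"]) (use bound q r0 in auto)
qed

text \<open>Factor by factor: (1 - x q^j/q^n) q^n = -x q^j (1 - (1/x) q^n/q^j).\<close>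

lemma qpoch_shift:
  assumes "x \<noteq> 0" "q \<noteq> 0"
  shows "qpoch (x / q ^ n) q k * (q ^ n) ^ k = (- x) ^ k * (\<Prod>j<k. q ^ j) * rev_qpoch (1 / x) q n k"
proof -
  have "qpoch (x / q ^ n) q k * (q ^ n) ^ k = (\<Prod>j<k. (1 - x / q ^ n * q ^ j) * q ^ n)"
    by (simp add: qpoch_def prod.distrib)
  also have "\<dots> = (\<Prod>j<k. - x * q ^ j * (1 - 1 / x * (q ^ n / q ^ j)))"
    using assms by (intro prod.cong) (auto simp: field_simps)
  also have "\<dots> = (- x) ^ k * (\<Prod>j<k. q ^ j) * rev_qpoch (1 / x) q n k"
    by (simp only: prod.distrib prod_constant card_lessThan rev_qpoch_def)
  finally show ?thesis .
qed

text \<open>Each product is q^(k(k-1)/2), and k(k-1) + k = k^2. This is how the Gaussian factor of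
  the Ramanujan series arises.\<close>

lemma prod_power_square:
  fixes q :: "'a :: comm_semiring_1"
  shows "(\<Prod>j<k. q ^ j) * (\<Prod>j<k. q ^ j) * q ^ k = q ^ k\<^sup>2"
proof (induction k)
  case (Suc k)
  have "(\<Prod>j<Suc k. q ^ j) * (\<Prod>j<Suc k. q ^ j) * q ^ Suc k
      = ((\<Prod>j<k. q ^ j) * (\<Prod>j<k. q ^ j) * q ^ k) * (q ^ k * q ^ Suc k)"
    by (simp add: mult_ac)
  also have "\<dots> = q ^ (Suc k)\<^sup>2"
    unfolding Suc.IH by (simp add: power2_eq_square algebra_simps flip: power_add power_Suc)
  finally show ?case .
qed simp

text \<open>The factor j = n is 1 - q^n/q^n; this is the termination of the series caused by the
  parameter q^(-n).\<close>

lemma rev_qpoch_eq_0: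
  assumes "q \<noteq> 0" "n < k"
  shows "rev_qpoch 1 q n k = 0"
  unfolding rev_qpoch_def using assms by (auto simp: prod_zero_iff)

section \<open>From termwise errors to the error of the sum\<close>

text \<open>Dominated convergence with a rate: each term errs by at most a constant times r(n) |a
  k|/q^k, and these weights are summable. The tail k > n obeys the same bound, because there |h - 1|
  = 1 and q^k \<le> q^n \<le> r(n).\<close>

lemma near_one_suminf:
  assumes h: "near_one q r h" and q: "0 < q" "q < 1" and r: "\<And>n. q ^ n \<le> r n"
    and h0: "\<And>n k. n < k \<Longrightarrow> h n k = 0"
    and a: "summable (\<lambda>k. norm (a k) / q ^ k)" "summable a"
  shows "(\<lambda>n. (\<Sum>k. a k * h n k) - (\<Sum>k. a k)) \<in> O(r)"
proof -
  obtain C where C: "C \<ge> 0" "\<forall>\<^sub>F n in sequentially. \<forall>k\<le>n.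
      norm (h n k) \<le> C \<and> norm (h n k - 1) \<le> C * (r n / q ^ k)"
    using h unfolding near_one_def by blast
  have r0: "0 \<le> r n" for n using r[of n] q by (meson zero_le_power less_imp_le order_trans)
  \<comment> \<open>\<open>C\<close> serves the range k \<le> n and 1 the tail k > n.\<close>
  define D where "D = max 1 C"
  have "\<forall>\<^sub>F n in sequentially. norm ((\<Sum>k. a k * h n k) - (\<Sum>k. a k)) \<le>
      (D * (\<Sum>k. norm (a k) / q ^ k)) * norm (complex_of_real (r n))"
    using C(2)
  proof eventually_elim
    case (elim n)
    have le: "norm (h n k - 1) \<le> D * (r n / q ^ k)" for k
    proof (cases "k \<le> n")
      case True
      then have "norm (h n k - 1) \<le> C * (r n / q ^ k)" using elim by blast
      also have "\<dots> \<le> D * (r n / q ^ k)"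
        using q r0 by (intro mult_right_mono) (auto simp: D_def)
      finally show ?thesis .
    next
      case False
      have "q ^ k \<le> r n"
        using r[of n] power_decreasing[of n k q] False q by linarith
      then have "1 \<le> r n / q ^ k" using q by simp
      then have "1 * 1 \<le> D * (r n / q ^ k)"
        by (intro mult_mono) (auto simp: D_def)
      then show ?thesis using h0 False by simp
    qed
    have le': "norm (a k * (h n k - 1)) \<le> D * r n * (norm (a k) / q ^ k)" for k
      using mult_left_mono[OF le, of "norm (a k)"] by (simp add: norm_mult mult_ac)
    have sg: "summable (\<lambda>k. D * r n * (norm (a k) / q ^ k))"
      by (intro summable_mult a)
    have sn: "summable (\<lambda>k. norm (a k * (h n k - 1)))"
      by (rule summable_comparison_test'[OF sg, of 0]) (use le' in auto)
    have "(\<Sum>k. a k * h n k) = (\<Sum>k. a k * (h n k - 1) + a k)"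
      by (simp add: algebra_simps)
    also have "\<dots> = (\<Sum>k. a k * (h n k - 1)) + (\<Sum>k. a k)"
      by (rule suminf_add[symmetric]) (use summable_norm_cancel[OF sn] a in auto)
    finally have "norm ((\<Sum>k. a k * h n k) - (\<Sum>k. a k)) = norm (\<Sum>k. a k * (h n k - 1))"
      by simp
    also have "\<dots> \<le> (\<Sum>k. norm (a k * (h n k - 1)))" by (rule summable_norm[OF sn])
    also have "\<dots> \<le> (\<Sum>k. D * r n * (norm (a k) / q ^ k))"
      by (intro suminf_le le' sn sg)
    also have "\<dots> = D * r n * (\<Sum>k. norm (a k) / q ^ k)"
      by (intro suminf_mult a)
    finally show ?case using r0[of n] by (simp add: mult_ac)
  qed
  then show ?thesis by (rule bigoI)
qed

lemma qpoch_self_nonzero: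
  assumes "0 < q" "q < 1"
  shows "qpoch (complex_of_real q) (complex_of_real q) k \<noteq> 0"
proof -
  have "1 - complex_of_real q * complex_of_real q ^ j \<noteq> 0" for j
  proof -
    have "q ^ Suc j < 1" using assms by (intro power_Suc_less_one)
    then have "1 - q * q ^ j \<noteq> 0" by simp
    then have "complex_of_real (1 - q * q ^ j) \<noteq> 0" by (simp only: of_real_eq_0_iff not_False_eq_True)
    then show ?thesis by simp
  qed
  then show ?thesis by (simp add: qpoch_def prod_zero_iff)
qed

text \<open>Passing from k to k + 1 multiplies q^(k^2) by q^(2k+1), so the ratio of consecutive
  terms tends to 0 for every geometric weight s^(-k). The case s = q absorbs the loss q^(-k), and s
  = 1 gives plain convergence.\<close>

lemma summable_ramanujan_div_power:
  fixes y :: complex and s :: real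
  assumes q: "0 < q" "q < 1" and s: "0 < s"
  shows "summable (\<lambda>k. norm (complex_of_real q ^ (k\<^sup>2) /
      qpoch (complex_of_real q) (complex_of_real q) k * y ^ k) / s ^ k)"
proof -
  define Q where "Q = complex_of_real q"
  define a where "a = (\<lambda>k. norm (Q ^ (k\<^sup>2) / qpoch Q Q k * y ^ k) / s ^ k)"
  \<comment> \<open>The factor 1/(1 - q) bounds 1/|1 - q^(k+1)| for all \<open>k\<close>.\<close>
  define M where "M = norm y / s / (1 - q)"
  have M0: "M \<ge> 0" using q s by (simp add: M_def)
  have nQ: "norm Q = q" using q by (simp add: Q_def)
  have step: "a (Suc k) \<le> (M * q ^ k) * a k" for k
  proof -
    have "(Suc k)\<^sup>2 = k\<^sup>2 + (k + Suc k)" by (simp add: power2_eq_square)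
    then have e: "Q ^ (Suc k)\<^sup>2 = Q ^ k\<^sup>2 * Q ^ (k + Suc k)" by (simp only: power_add)
    have "norm (1 - Q * Q ^ k) \<ge> 1 - q"
    proof -
      have "norm (1 - Q * Q ^ k) \<ge> 1 - q * q ^ k"
        using norm_triangle_ineq2[of 1 "Q * Q ^ k"] by (simp add: norm_mult norm_power nQ)
      moreover have "q * q ^ k \<le> q" using q by (simp add: mult_left_le power_le_one)
      ultimately show ?thesis by linarith
    qed
    then have d: "1 / norm (1 - Q * Q ^ k) \<le> 1 / (1 - q)"
      using q by (intro divide_left_mono mult_pos_pos) auto
    have "a (Suc k) = a k * (norm y / s * q ^ (k + Suc k)) * (1 / norm (1 - Q * Q ^ k))"
      unfolding a_def e qpoch_def
      by (simp add: norm_mult norm_divide norm_power nQ divide_simps)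
    also have "\<dots> \<le> a k * (norm y / s * q ^ (k + Suc k)) * (1 / (1 - q))"
      using q s by (intro mult_left_mono d) (auto simp: a_def)
    also have "\<dots> = (a k * M) * q ^ (k + Suc k)" by (simp add: M_def)
    also have "\<dots> \<le> (a k * M) * q ^ k"
      using q s M0 by (intro mult_left_mono power_decreasing) (auto simp: a_def)
    finally show ?thesis by (simp add: mult_ac)
  qed
  have "(\<lambda>k. M * q ^ k) \<longlonglongrightarrow> 0"
    using q by (intro tendsto_mult_right_zero LIMSEQ_realpow_zero) auto
  then have "\<forall>\<^sub>F k in sequentially. M * q ^ k < 1/2"
    by (rule order_tendstoD) simp
  then obtain N where N: "\<And>k. k \<ge> N \<Longrightarrow> M * q ^ k < 1/2"
    by (auto simp: eventually_sequentially)
  have a0: "a k \<ge> 0" for k using s by (simp add: a_def)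
  have "summable a"
  proof (rule summable_ratio_test[of "1/2" N])
    fix k assume "N \<le> k"
    then have "(M * q ^ k) * a k \<le> 1/2 * a k" using N[of k] a0 by (intro mult_right_mono) auto
    with step[of k] a0 show "norm (a (Suc k)) \<le> 1/2 * norm (a k)" by simp
  qed simp
  then show ?thesis by (simp add: a_def Q_def)
qed

section \<open>Asymptotics of \<open>V_zeta\<close> under abstract size conditions\<close>

text \<open>The two numerator parameters of size q^(-n) each absorb one of the two factors
  \<open>Q ^ n\<close> of the argument, by \<open>qpoch_shift\<close>; their signs (-1)^k
  cancel.\<close>

lemma phi32_term_eq:
  fixes Q w s a b c :: complex
  assumes "Q \<noteq> 0" "w \<noteq> 0"
  shows "qpochs [1 / Q ^ n, a, w / Q ^ n] Q k / qpochs [Q, b, c] Q k * (s * Q ^ n * Q ^ n) ^ k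
    = Q ^ k\<^sup>2 / qpoch Q Q k * (w * s / Q) ^ k *
      (rev_qpoch 1 Q n k * rev_qpoch (1 / w) Q n k * qpoch a Q k *
       inverse (qpoch b Q k) * inverse (qpoch c Q k))"
proof -
  define e where "e = (\<Prod>j<k. Q ^ j)"
  \<comment> \<open>By \<open>prod_power_square\<close>, \<open>e * e\<close> is Q^(k^2)/Q^k; the
    leftover Q^(-k) moves into the argument.\<close>
  have e: "(w * s) ^ k * (e * e) = Q ^ k\<^sup>2 * (w * s / Q) ^ k"
    using assms prod_power_square[of Q k] by (simp add: e_def power_divide field_simps)
  have "qpochs [1 / Q ^ n, a, w / Q ^ n] Q k / qpochs [Q, b, c] Q k * (s * Q ^ n * Q ^ n) ^ k
    = (qpoch (1 / Q ^ n) Q k * (Q ^ n) ^ k) * (qpoch (w / Q ^ n) Q k * (Q ^ n) ^ k) * s ^ k *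
      qpoch a Q k / (qpoch Q Q k * qpoch b Q k * qpoch c Q k)"
    by (simp add: qpochs_def power_mult_distrib mult_ac)
  also have "\<dots> = ((-1) ^ k * e * rev_qpoch 1 Q n k) * ((- w) ^ k * e * rev_qpoch (1 / w) Q n k)
      * s ^ k * qpoch a Q k / (qpoch Q Q k * qpoch b Q k * qpoch c Q k)"
    using qpoch_shift[of 1 Q n k] qpoch_shift[of w Q n k] assms by (simp only: e_def) simp
  also have "\<dots> = ((w * s) ^ k * (e * e)) * (rev_qpoch 1 Q n k * rev_qpoch (1 / w) Q n k)
      * qpoch a Q k / (qpoch Q Q k * qpoch b Q k * qpoch c Q k)"
  proof -
    have "(- w) ^ k = (-1) ^ k * w ^ k" by (rule power_minus)
    then have "(-1) ^ k * (- w) ^ k = w ^ k"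
      by (simp flip: mult.assoc power_mult_distrib)
    then have "((-1) ^ k * e * A) * ((- w) ^ k * e * B) * s ^ k = ((w * s) ^ k * (e * e)) * (A * B)"
      for A B by (simp add: power_mult_distrib mult_ac flip: mult.assoc[of "(-1) ^ k" "(- w) ^ k"])
    then show ?thesis by simp
  qed
  \<comment> \<open>The factorials of \<open>b\<close> and \<open>c\<close> may vanish; with
    \<open>inverse 0 = 0\<close> both sides still agree.\<close>
  finally show ?thesis
    unfolding e by (simp only: divide_inverse inverse_mult_distrib mult_ac)
qed

text \<open>What matters about the scaling is that four parameters are O(r n), while q \<zeta>/T1
  and the argument of the series carry exact powers of \<open>Q ^ n\<close>. Then every factor
  besides the Ramanujan term is \<open>near_one\<close>.\<close>

lemma V_zeta_asymptotics:
  fixes q :: real and w s :: complex and \<zeta> T1 T2 T3 :: "nat \<Rightarrow> complex"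
  defines "Q \<equiv> complex_of_real q"
  assumes q: "0 < q" "q < 1" and r: "\<And>n. q ^ n \<le> r n" "r \<longlonglongrightarrow> 0"
    and w: "w \<noteq> 0" and T1: "\<And>n. T1 n \<noteq> 0"
    and a: "\<And>n. norm (- Q / (T1 n * \<zeta> n)) \<le> A * r n"
    and b: "\<And>n. norm (- (Q\<^sup>2) / (T1 n * T3 n)) \<le> B * r n"
    and c: "\<And>n. norm (- (Q\<^sup>2) / (T1 n * T2 n)) \<le> C * r n"
    and d: "\<And>n. norm (- (Q\<^sup>2) / (T2 n * T3 n)) \<le> D * r n"
    and weq: "\<And>n. Q * \<zeta> n / T1 n = w / Q ^ n"
    and seq: "\<And>n. - (Q ^ (n + 2)) / (T2 n * T3 n) = s * Q ^ n * Q ^ n"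
  shows "(\<lambda>n. V_zeta n (\<zeta> n) (T1 n) (T2 n) (T3 n) Q / (T1 n / Q) ^ n - ramanujan_A Q (- w * s / Q))
    \<in> O(r)"
proof -
  have Q0: "Q \<noteq> 0" using q by (simp add: Q_def)
  have r0: "0 \<le> r n" for n using r(1)[of n] q by (meson zero_le_power less_imp_le order_trans)
  define y where "y = w * s / Q"
  define a' where "a' = (\<lambda>n. - Q / (T1 n * \<zeta> n))"
  define b' where "b' = (\<lambda>n. - (Q\<^sup>2) / (T1 n * T3 n))"
  define c' where "c' = (\<lambda>n. - (Q\<^sup>2) / (T1 n * T2 n))"
  define d' where "d' = (\<lambda>n. - (Q\<^sup>2) / (T2 n * T3 n))"
  define g where "g = (\<lambda>n k. rev_qpoch 1 Q n k * rev_qpoch (1 / w) Q n k * qpoch (a' n) Q k *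
       inverse (qpoch (b' n) Q k) * inverse (qpoch (c' n) Q k))"
  \<comment> \<open>The prefactor, independent of \<open>k\<close>, is moved inside the sum so that
    a single estimate handles everything.\<close>
  define h where "h = (\<lambda>n k. qpoch (b' n) Q n * inverse (qpoch (d' n) Q n) * g n k)"
  define u where "u = (\<lambda>k. Q ^ k\<^sup>2 / qpoch Q Q k * y ^ k)"
  note near = near_one_qpoch[OF q r0 r(2), folded Q_def]
  have "near_one q r h"
    unfolding h_def g_def
    by (intro near_one_mult r0 q near_one_rev_qpoch[OF q r(1), folded Q_def]
        near(1)[where a = a' and A = A] near(1)[where a = b' and A = B] near(2)[where a = b' and A = B]
        near(2)[where a = c' and A = C] near(2)[where a = d' and A = D])
      (use a b c d in \<open>auto simp: a'_def b'_def c'_def d'_def\<close>)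
  moreover have g0: "g n k = 0" if "n < k" for n k
    using rev_qpoch_eq_0[OF Q0 that] by (simp add: g_def)
  moreover have "summable (\<lambda>k. norm (u k) / q ^ k)"
    unfolding u_def Q_def by (rule summable_ramanujan_div_power[OF q q(1)])
  moreover have "summable u"
    using summable_ramanujan_div_power[OF q, of 1 y]
    by (simp add: u_def Q_def summable_norm_cancel)
  ultimately have "(\<lambda>n. (\<Sum>k. u k * h n k) - (\<Sum>k. u k)) \<in> O(r)"
    by (intro near_one_suminf[OF _ q r(1)]) (auto simp: h_def)
  moreover have "(\<Sum>k. u k * h n k) = V_zeta n (\<zeta> n) (T1 n) (T2 n) (T3 n) Q / (T1 n / Q) ^ n" for n
  proof -
    \<comment> \<open>Only the terms k \<le> n are nonzero.\<close>
    have "summable (\<lambda>k. u k * g n k)"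
      by (rule summable_finite[of "{..n}"]) (use g0 in auto)
    then have "(\<Sum>k. u k * h n k) =
        qpoch (b' n) Q n * inverse (qpoch (d' n) Q n) * (\<Sum>k. u k * g n k)"
      by (subst suminf_mult[symmetric]) (simp_all add: h_def mult_ac)
    also have "(\<Sum>k. u k * g n k) = phi32 (1 / Q ^ n) (a' n) (w / Q ^ n) (b' n) (c' n) Q (s * Q ^ n * Q ^ n)"
      unfolding phi32_def phi32_term_eq[OF Q0 w] u_def g_def y_def ..
    finally show ?thesis
      unfolding V_zeta_def weq seq using T1[of n] Q0
      by (simp add: a'_def b'_def c'_def d'_def power_int_minus field_simps)
  qed
  moreover have "(\<Sum>k. u k) = ramanujan_A Q (- w * s / Q)"
    by (simp add: u_def ramanujan_A_def y_def)
  ultimately show ?thesis by simp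
qed

section \<open>The concrete scaling by powers of q^n\<close>

theorem theorem6p2:
  fixes q \<alpha> \<beta> \<gamma> \<delta> :: real and z t1 t2 t3 :: complex
  assumes "0 < q" "q < 1"
    and "\<alpha> > \<beta>" "\<beta> > 0" "\<gamma> > 0" "\<delta> > 0"
    and "\<gamma> + \<delta> = 1" "\<alpha> - \<beta> = 1"
    and "z * t1 * t2 * t3 \<noteq> 0"
  shows "\<exists>\<eta>::real. 0 < \<eta> \<and> \<eta> < Min {1, \<alpha> + \<beta>, \<beta> + \<delta>, \<beta> + \<gamma>} \<and>
    (\<exists>E :: nat \<Rightarrow> complex.
       E \<in> O(\<lambda>n. complex_of_real (q powr (\<eta> * real n))) \<and>
       (\<forall>\<^sub>F n in sequentially.
          V n (x2 q \<alpha> z n)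
            (t1 * complex_of_real (q powr (- real n * \<beta>)))
            (t2 * complex_of_real (q powr (- real n * \<gamma>)))
            (t3 * complex_of_real (q powr (- real n * \<delta>)))
            (complex_of_real q) =
          t1 ^ n / complex_of_real (q powr ((real n) ^ 2 * \<beta> + real n)) *
            (ramanujan_A (complex_of_real q) ((complex_of_real q) ^ 2 * z / (t1 * t2 * t3)) + E n)))"
proof -
  define Q where "Q = complex_of_real q"
  define \<mu> where "\<mu> = Min {1, \<alpha> + \<beta>, \<beta> + \<delta>, \<beta> + \<gamma>}"
  \<comment> \<open>Half the minimum meets the strict inequality. The entries of the minimum are the
    decay exponents of the small parameters: \<alpha> + \<beta> for -q/(t1 \<zeta>), \<beta> +
    \<delta> for t1 t3, \<beta> + \<gamma> for t1 t2, and \<gamma> + \<delta> = 1 for t2 t3; 1 is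
    also the exponent of q^n.\<close>
  define \<eta> where "\<eta> = \<mu> / 2"
  have \<mu>: "0 < \<mu>" "\<mu> \<le> 1" "\<mu> \<le> \<alpha> + \<beta>" "\<mu> \<le> \<beta> + \<delta>" "\<mu> \<le> \<beta> + \<gamma>"
    using assms by (auto simp: \<mu>_def)
  have \<eta>: "0 < \<eta>" "\<eta> < \<mu>" using \<mu> by (auto simp: \<eta>_def)
  define r where "r = (\<lambda>n. q powr (\<eta> * real n))"
  define P where "P = (\<lambda>x n. complex_of_real (q powr (real n * x)))"
  have nz: "z \<noteq> 0" "t1 \<noteq> 0" "t2 \<noteq> 0" "t3 \<noteq> 0" using assms by auto
  have Q0: "Q \<noteq> 0" using assms by (simp add: Q_def)
  have P0: "P x n \<noteq> 0" for x n using assms by (simp add: P_def)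
  have P_add: "P x n * P y n = P (x + y) n" for x y n
    by (simp add: P_def powr_add distrib_left)
  have P_1: "P 1 n = Q ^ n" for n
    using assms by (simp add: P_def Q_def powr_realpow)
  have P_minus: "complex_of_real (q powr (- real n * x)) = 1 / P x n" for n x
    by (simp add: P_def powr_minus_divide)
  \<comment> \<open>As q < 1, a larger exponent gives a smaller power.\<close>
  have norm_P: "norm (P x n) \<le> r n" if "\<eta> \<le> x" for x n
  proof -
    have "q powr (real n * x) \<le> q powr (\<eta> * real n)"
      using assms that by (intro powr_mono') (auto simp: mult.commute[of _ "real n"] mult_left_mono)
    then show ?thesis by (simp add: P_def r_def)
  qed
  have norm_cP: "norm (c * P x n) \<le> norm c * r n" if "\<eta> \<le> x" for c x n
    unfolding norm_mult by (intro mult_left_mono norm_P that) simp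
  have qr: "q ^ n \<le> r n" for n
    using norm_P[of 1 n] P_1[of n] \<mu> \<eta> assms by (simp add: Q_def norm_power)
  have r_lim: "r \<longlonglongrightarrow> 0"
  proof -
    have "q powr \<eta> > 0" using assms(1) by simp
    then have "r = (\<lambda>n. (q powr \<eta>) ^ n)"
      by (simp add: r_def powr_powr[symmetric] powr_realpow assms(1))
    moreover have "q powr \<eta> < 1" using powr_less_mono'[of q 0 \<eta>] assms(1,2) \<eta> by simp
    ultimately show ?thesis by (simp add: LIMSEQ_realpow_zero)
  qed
  define \<zeta> where "\<zeta> = (\<lambda>n. z / P \<alpha> n)"
  define T1 where "T1 = (\<lambda>n. t1 / P \<beta> n)"
  define T2 where "T2 = (\<lambda>n. t2 / P \<gamma> n)"
  define T3 where "T3 = (\<lambda>n. t3 / P \<delta> n)"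
  \<comment> \<open>\<open>w\<close> and \<open>s\<close> are what q \<zeta>/T1 and the argument of
    the series leave after their powers of q^n are removed: q^(-n) in the first, as \<alpha> -
    \<beta> = 1, and q^(2n) in the second, one q^n being explicit and one due to \<gamma> + \<delta>
    = 1.\<close>
  define w where "w = Q * z / t1"
  define s where "s = - (Q\<^sup>2) / (t2 * t3)"
  define W where "W = (\<lambda>n. V_zeta n (\<zeta> n) (T1 n) (T2 n) (T3 n) Q)"
  have "(\<lambda>n. W n / (T1 n / Q) ^ n - ramanujan_A Q (- w * s / Q)) \<in> O(r)"
    unfolding W_def Q_def
  proof (rule V_zeta_asymptotics[OF assms(1,2) qr r_lim], unfold Q_def[symmetric])
    fix n
    show "w \<noteq> 0" using nz Q0 by (simp add: w_def)
    show "T1 n \<noteq> 0" using nz P0 by (simp add: T1_def)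
    have "- Q / (T1 n * \<zeta> n) = - Q / (t1 * z) * P (\<alpha> + \<beta>) n"
      by (simp add: T1_def \<zeta>_def mult_ac flip: P_add)
    then show "norm (- Q / (T1 n * \<zeta> n)) \<le> norm (- Q / (t1 * z)) * r n"
      by (simp only:) (rule norm_cP, use \<mu> \<eta> in linarith)
    have "- (Q\<^sup>2) / (T1 n * T3 n) = - (Q\<^sup>2) / (t1 * t3) * P (\<beta> + \<delta>) n"
      by (simp add: T1_def T3_def mult_ac flip: P_add)
    then show "norm (- (Q\<^sup>2) / (T1 n * T3 n)) \<le> norm (- (Q\<^sup>2) / (t1 * t3)) * r n"
      by (simp only:) (rule norm_cP, use \<mu> \<eta> in linarith)
    have "- (Q\<^sup>2) / (T1 n * T2 n) = - (Q\<^sup>2) / (t1 * t2) * P (\<beta> + \<gamma>) n"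
      by (simp add: T1_def T2_def mult_ac flip: P_add)
    then show "norm (- (Q\<^sup>2) / (T1 n * T2 n)) \<le> norm (- (Q\<^sup>2) / (t1 * t2)) * r n"
      by (simp only:) (rule norm_cP, use \<mu> \<eta> in linarith)
    have T23: "T2 n * T3 n = t2 * t3 / Q ^ n"
      using P_add[of \<gamma> n \<delta>] assms(7) by (simp add: T2_def T3_def P_1)
    have "- (Q\<^sup>2) / (T2 n * T3 n) = - (Q\<^sup>2) / (t2 * t3) * P 1 n"
      by (simp add: T23 P_1)
    then show "norm (- (Q\<^sup>2) / (T2 n * T3 n)) \<le> norm (- (Q\<^sup>2) / (t2 * t3)) * r n"
      by (simp only:) (rule norm_cP, use \<mu> \<eta> in linarith)
    have "P \<alpha> n = P \<beta> n * Q ^ n"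
      using P_add[of \<beta> n 1] assms(8) by (simp add: P_1 algebra_simps)
    then show "Q * \<zeta> n / T1 n = w / Q ^ n"
      using P0 by (simp add: \<zeta>_def T1_def w_def)
    show "- (Q ^ (n + 2)) / (T2 n * T3 n) = s * Q ^ n * Q ^ n"
      by (simp add: T23 s_def power_add power2_eq_square)
  qed
  moreover have "- w * s / Q = Q\<^sup>2 * z / (t1 * t2 * t3)"
    using Q0 by (simp add: w_def s_def mult_ac)
  ultimately have big: "(\<lambda>n. W n / (T1 n / Q) ^ n - ramanujan_A Q (Q\<^sup>2 * z / (t1 * t2 * t3))) \<in> O(r)"
    by simp
  have pref: "(T1 n / Q) ^ n = t1 ^ n / complex_of_real (q powr ((real n)\<^sup>2 * \<beta> + real n))" for n
  proof -
    have "q powr ((real n)\<^sup>2 * \<beta> + real n) = (q powr (real n * \<beta>) * q) ^ n"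
      using assms by (simp add: powr_add powr_realpow power_mult_distrib powr_power power2_eq_square mult_ac)
    then show ?thesis by (simp add: T1_def P_def Q_def power_divide)
  qed
  \<comment> \<open>\<open>V\<close> picks some root of x = (\<zeta> - 1/\<zeta>)/2;
    \<open>V_eq_V_zeta\<close> allows the root z q^(-n \<alpha>) instead.\<close>
  have VW: "V n (x2 q \<alpha> z n) (t1 * complex_of_real (q powr (- real n * \<beta>)))
      (t2 * complex_of_real (q powr (- real n * \<gamma>))) (t3 * complex_of_real (q powr (- real n * \<delta>)))
      (complex_of_real q) = W n" for n
  proof -
    have "x2 q \<alpha> z n = (\<zeta> n - 1 / \<zeta> n) / 2"
      unfolding x2_def P_minus by (simp add: \<zeta>_def P_def)
    moreover have "\<zeta> n \<noteq> 0" using nz P0 by (simp add: \<zeta>_def)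
    ultimately show ?thesis
      by (simp only: V_eq_V_zeta P_minus W_def T1_def T2_def T3_def Q_def
          not_False_eq_True times_divide_eq_right mult_1_right)
  qed
  have cancel: "c * (a + (v / c - a)) = v" if "c \<noteq> 0" for a c v :: complex
    using that by simp
  have T10: "(T1 n / Q) ^ n \<noteq> 0" for n using nz P0 Q0 by (simp add: T1_def)
  show ?thesis
  \<comment> \<open>\<open>E\<close> is the normalised value minus its limit. The expansion is then
    an identity for every \<open>n\<close>, and the content lies in the bound
    \<open>big\<close>.\<close>
  proof (intro exI conjI)
    show "0 < \<eta>" "\<eta> < Min {1, \<alpha> + \<beta>, \<beta> + \<delta>, \<beta> + \<gamma>}"
      using \<eta> by (simp_all only: \<mu>_def)
    show "(\<lambda>n. W n / (T1 n / Q) ^ n - ramanujan_A Q (Q\<^sup>2 * z / (t1 * t2 * t3)))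
        \<in> O(\<lambda>n. complex_of_real (q powr (\<eta> * real n)))"
      using big by (simp add: r_def bigo_def)
    show "\<forall>\<^sub>F n in sequentially.
          V n (x2 q \<alpha> z n)
            (t1 * complex_of_real (q powr (- real n * \<beta>)))
            (t2 * complex_of_real (q powr (- real n * \<gamma>)))
            (t3 * complex_of_real (q powr (- real n * \<delta>)))
            (complex_of_real q) =
          t1 ^ n / complex_of_real (q powr ((real n) ^ 2 * \<beta> + real n)) *
            (ramanujan_A (complex_of_real q) ((complex_of_real q) ^ 2 * z / (t1 * t2 * t3)) +
              (W n / (T1 n / Q) ^ n - ramanujan_A Q (Q\<^sup>2 * z / (t1 * t2 * t3))))"
      unfolding VW unfolding pref[symmetric] Q_def[symmetric]
      by (rule always_eventually, rule allI, rule sym, rule cancel, rule T10)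
  qed
qed

end
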